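(* Let $p\in\mathcal{H}_1$ and let $\beta$ be a real number. Then each of the following subordinations is sufficient for $p(z)\prec e^z$: (a) $p(z)+\beta(zp'(z))^2\prec e^z$, where $\beta\ge e^3-e$ $(\approx 17.3673)$; (b) $p(z)+\beta\dfrac{(zp'(z))^2}{p(z)}\prec e^z$, where $\beta\ge e^2-1$ $(\approx 6.38906)$; (c) $p(z)+\beta\dfrac{(zp'(z))^2}{p^2(z)}\prec e^z$, where $\beta\ge e-e^{-1}$ $(\approx 2.3504)$.
   Context: $\mathbb{D}=\{z\in\mathbb{C}:|z|<1\}$. $\mathcal{H}_1$ is the class of analytic functions on $\mathbb{D}$ of the form $p(z)=1+a_1z+a_2z^2+\cdots$. $p^2(z)$ means $(p(z))^2$. For functions $F,G$ analytic in $\mathbb{D}$, $F\prec G$ (F is subordinate to G) means there is an analytic $w:\mathbb{D}\to\mathbb{C}$ with $w(0)=0$, $|w(z)|<1$ and $F(z)=G(w(z))$ for all $z\in\mathbb{D}$; writing $F\prec G$ presupposes that $F$ and $G$ are analytic in $\mathbb{D}$. *)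

theory Defs
  imports "HOL-Complex_Analysis.Complex_Analysis"
begin

definition unit_disc :: "complex set" where
  "unit_disc = {z. norm z < 1}"

text \<open>The normalised class of power series \<open>1 + a\<^sub>1 z + a\<^sub>2 z\<^sup>2 + \<dots>\<close> converging in the unit disc;
  by Taylor expansion only the constant coefficient is constrained.\<close>

definition class_H1 :: "(complex \<Rightarrow> complex) set" where
  "class_H1 = {p. p analytic_on unit_disc \<and> p 0 = 1}"

definition subordinate :: "(complex \<Rightarrow> complex) \<Rightarrow> (complex \<Rightarrow> complex) \<Rightarrow> bool"
    (infix "\<prec>\<^sub>s" 50) where
  "F \<prec>\<^sub>s G \<longleftrightarrow>
     F analytic_on unit_disc \<and> G analytic_on unit_disc \<and>
     (\<exists>w. w analytic_on unit_disc \<and> w 0 = 0 \<and>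
          (\<forall>z\<in>unit_disc. norm (w z) < 1 \<and> F z = G (w z)))"

text \<open>Quotients by \<open>p\<close> are read as meromorphic functions: \<^const>\<open>remove_sings\<close> extends
  the expression analytically over its removable singularities (e.g. \<open>(z p'(z))\<^sup>2 / p(z)\<close> at a
  double zero of \<open>p\<close>). This avoids the HOL convention \<open>x / 0 = 0\<close> deciding the value at a zero of
  \<open>p\<close>. Where \<open>p\<close> does not vanish, \<^const>\<open>remove_sings\<close> changes nothing. At a pole
  \<^const>\<open>remove_sings\<close> has the value 0, which \<^const>\<open>exp\<close> does not attain, so a function with a
  pole in the disc is never subordinate to \<^const>\<open>exp\<close>.\<close>

end

theory Submission
  imports Defs
begin

text \<open>
  If \<open>p\<close> is not subordinate to \<open>exp\<close>, take a point \<open>z\<close> of least modulus at which \<open>p\<close> leaves the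
  image of the disc. There \<open>p z = exp \<zeta>\<close> with \<open>\<bar>\<zeta>\<bar> = 1\<close>, and Jack's lemma for \<open>Ln \<circ> p\<close> gives
  \<open>z p'(z) = m \<zeta> exp \<zeta>\<close> with \<open>m \<ge> 1\<close>. With \<open>\<gamma> = \<beta> m\<^sup>2 \<ge> \<beta>\<close>, the three expressions
  at \<open>z\<close> become \<open>exp \<zeta> + \<gamma> (\<zeta> exp \<zeta>)\<^sup>2\<close>, \<open>exp \<zeta> (1 + \<gamma> \<zeta>\<^sup>2)\<close> and \<open>exp \<zeta> + \<gamma> \<zeta>\<^sup>2\<close>. The image of the
  disc under \<open>exp\<close> lies in \<open>{w. \<bar>w\<bar> < e}\<close> and in the smaller disc \<open>{w. \<bar>w - 1\<bar> < e - 1}\<close>; the first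
  two expressions lie outside the former and the third lies outside the latter, the extremal case
  being \<open>\<zeta> = -1\<close> each time.
\<close>


section \<open>Jack's lemma at a first contact with the unit circle\<close>

text \<open>The Schwarz lemma on the rescaled disc gives
  \<open>norm (f (z * x)) \<le> norm x\<close>. Since \<open>f (z * x) / f z\<close> equals 1 at
  \<open>x = 1\<close>, its derivative \<open>k\<close> there must be real and at least 1.\<close>

lemma Jack_lemma:
  fixes f :: "complex \<Rightarrow> complex"
  assumes hol: "f holomorphic_on ball 0 (norm z)" and "f 0 = 0" and "z \<noteq> 0"
    and less1: "\<And>x. norm x < norm z \<Longrightarrow> norm (f x) < 1" and norm1: "norm (f z) = 1"
    and deriv: "(f has_field_derivative f') (at z)"
  obtains m :: real where "m \<ge> 1" "z * f' = of_real m * f z"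
proof -
  define k where "k = z * f' / f z"
  have fz: "f z \<noteq> 0" using norm1 by auto
  have Schwarz: "norm (f (z * x)) \<le> norm x" if "norm x < 1" for x
  proof (rule Schwarz_Lemma(1)[of "\<lambda>x. f (z * x)"])
    have scaled: "norm (z * y) < norm z" if "norm y < 1" for y
      using that \<open>z \<noteq> 0\<close> by (simp add: norm_mult)
    have "(f \<circ> (*) z) holomorphic_on ball 0 1"
      using scaled by (intro holomorphic_on_compose_gen[OF _ hol] holomorphic_intros) auto
    then show "(\<lambda>x. f (z * x)) holomorphic_on ball 0 1" by (simp add: o_def)
    show "norm (f (z * y)) < 1" if "norm y < 1" for y
      using scaled[OF that] less1 by blast
  qed (use that \<open>f 0 = 0\<close> in auto)
  \<comment> \<open>Comparing \<open>f (z (1 + t d)) / f z\<close> with \<open>1 + t d\<close> to first order in \<open>t\<close> for every inward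
    direction \<open>d\<close> yields both that \<open>k\<close> is real and that \<open>k \<ge> 1\<close>. The quadratic term in \<open>\<phi>\<close> comes from
    \<open>\<bar>x\<bar> \<le> (1 + \<bar>x\<bar>\<^sup>2) / 2\<close>, which avoids differentiating the norm.\<close>
  have inward: "Re (k * d) \<le> Re d" if "Re d < 0" for d
  proof (rule ccontr)
    assume contra: "\<not> ?thesis"
    define \<phi> where
      "\<phi> t = Re (f (z * (1 + of_real t * d)) / f z) - (1 + t * Re d + t\<^sup>2 * (norm d)\<^sup>2 / 2)" for t
    have "((\<lambda>t. f (z * (1 + of_real t * d)) / f z) has_vector_derivative k * d) (at 0)"
    proof -
      have "((\<lambda>t. z * (1 + of_real t * d)) has_vector_derivative z * d) (at (0::real))"
        by (auto intro!: derivative_eq_intros)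
      moreover have "(f has_field_derivative f') (at (z * (1 + of_real 0 * d)))"
        using deriv by simp
      ultimately have "((f \<circ> (\<lambda>t. z * (1 + of_real t * d))) has_vector_derivative (z * d * f')) (at 0)"
        by (rule field_vector_diff_chain_at)
      then have "((\<lambda>t. f (z * (1 + of_real t * d)) / f z) has_vector_derivative (z * d * f') / f z) (at 0)"
        unfolding o_def by (rule has_vector_derivative_divide)
      then show ?thesis by (simp add: k_def mult_ac)
    qed
    then have "((\<lambda>t. Re (f (z * (1 + of_real t * d)) / f z)) has_real_derivative Re (k * d)) (at 0)"
      using has_field_derivative_Re by blast
    moreover have "((\<lambda>t. 1 + t * Re d + t\<^sup>2 * (norm d)\<^sup>2 / 2) has_real_derivative Re d) (at 0)"
      by (auto intro!: derivative_eq_intros)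
    ultimately have "(\<phi> has_real_derivative (Re (k * d) - Re d)) (at 0)"
      unfolding \<phi>_def by (rule DERIV_diff)
    then obtain \<delta> where \<delta>: "\<delta> > 0" "\<And>h. 0 < h \<Longrightarrow> h < \<delta> \<Longrightarrow> \<phi> 0 < \<phi> (0 + h)"
      using DERIV_pos_inc_right[of \<phi> "Re (k * d) - Re d" 0] contra by auto
    have "d \<noteq> 0" using that by auto
    \<comment> \<open>The first bound keeps \<open>t\<close> below \<open>\<delta>\<close>; the
      second yields \<open>(norm ?x)\<^sup>2 \<le> 1 + t * Re d < 1\<close>, so that the Schwarz
      bound applies at \<open>?x\<close>.\<close>
    define t where "t = min (\<delta> / 2) (- Re d / (norm d)\<^sup>2)"
    have t: "0 < t" "t < \<delta>" "t * (norm d)\<^sup>2 \<le> - Re d"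
      using \<delta>(1) that \<open>d \<noteq> 0\<close> by (auto simp: t_def min_def field_simps)
    let ?x = "1 + of_real t * d"
    have nx: "(norm ?x)\<^sup>2 = 1 + 2 * t * Re d + t * (t * (norm d)\<^sup>2)"
      unfolding cmod_power2 by (simp add: power2_eq_square algebra_simps)
    have "t * (t * (norm d)\<^sup>2) \<le> t * (- Re d)"
      using t by (intro mult_left_mono) auto
    moreover have "t * Re d < 0" using t that by (simp add: mult_pos_neg)
    ultimately have "(norm ?x)\<^sup>2 < 1" using nx by simp
    then have "norm ?x < 1" by (simp add: power_less_one_iff abs_square_less_1)
    then have "norm (f (z * ?x)) \<le> norm ?x" by (rule Schwarz)
    moreover have "Re (f (z * ?x) / f z) \<le> norm (f (z * ?x))"
      using complex_Re_le_cmod[of "f (z * ?x) / f z"] norm1 by (simp add: norm_divide)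
    moreover have "2 * norm ?x \<le> 1 + (norm ?x)\<^sup>2"
      using sum_squares_ge_zero[of "norm ?x - 1" 0] by (simp add: power2_eq_square algebra_simps)
    ultimately have "\<phi> t \<le> 0"
      unfolding \<phi>_def using nx by (simp add: power2_eq_square)
    moreover have "\<phi> 0 = 0" using fz by (simp add: \<phi>_def)
    ultimately show False using \<delta>(2)[of t] t by simp
  qed
  have Re: "Re k \<ge> 1" using inward[of "-1"] by simp
  have "Im k = 0"
  proof (rule ccontr)
    assume Im: "Im k \<noteq> 0"
    \<comment> \<open>This \<epsilon> makes \<open>Re (k * d) = 0\<close> for the inward direction
      \<open>d = Complex (-\<epsilon>) (- Im k)\<close>, contradicting
      \<open>Re (k * d) \<le> Re d < 0\<close>.\<close>
    define \<epsilon> where "\<epsilon> = (Im k)\<^sup>2 / Re k"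
    have \<epsilon>: "\<epsilon> > 0" "\<epsilon> * Re k = (Im k)\<^sup>2" using Im Re by (auto simp: \<epsilon>_def)
    have "Re (k * Complex (-\<epsilon>) (- Im k)) \<le> - \<epsilon>"
      using inward[of "Complex (-\<epsilon>) (- Im k)"] \<epsilon> by simp
    then show False using \<epsilon> by (simp add: power2_eq_square mult_ac)
  qed
  then have "k = of_real (Re k)" by (simp add: complex_eq_iff)
  then have "z * f' = of_real (Re k) * f z" using fz by (simp add: k_def field_simps)
  with Re show thesis by (rule that)
qed

section \<open>The logarithm on the image of the disc and the contact criterion\<close>

text \<open>As 1 < \<open>pi\<close>, the closed unit disc lies in the open strip where
  \<open>Ln\<close> inverts \<open>exp\<close>, so its image stays off the branch cut.\<close>

lemma Ln_exp_unit_cball: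
  fixes x :: complex
  assumes "norm x \<le> 1"
  shows "Ln (exp x) = x" and "exp x \<notin> \<real>\<^sub>\<le>\<^sub>0"
proof -
  have Im: "\<bar>Im x\<bar> < pi"
    using abs_Im_le_cmod[of x] assms pi_gt3 by linarith
  then show Ln: "Ln (exp x) = x" by (intro Ln_exp) auto
  show "exp x \<notin> \<real>\<^sub>\<le>\<^sub>0"
  proof
    assume "exp x \<in> \<real>\<^sub>\<le>\<^sub>0"
    then have "Im (exp x) = 0" "Re (exp x) \<le> 0" using complex_nonpos_Reals_iff by auto
    moreover from this have "Re (exp x) \<noteq> 0"
      using exp_not_eq_zero[of x] by (auto simp: complex_eq_iff simp del: exp_not_eq_zero)
    ultimately have "Im (Ln (exp x)) = pi" by (subst Im_Ln_eq_pi) auto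
    with Ln Im show False by simp
  qed
qed

lemma open_exp_image_disc: "open (exp ` ball (0::complex) 1)"
proof (rule open_mapping_thm3)
  show "inj_on exp (ball (0::complex) 1)"
    using Ln_exp_unit_cball(1) by (intro inj_on_inverseI[where g = Ln]) auto
qed (simp_all add: holomorphic_on_exp)

text \<open>Reduces subordination to pointwise inequalities on the unit circle: once contact is
  excluded, \<open>Ln\<close> composed with \<open>p\<close> is the required Schwarz
  function.\<close>

lemma subordinate_exp_criterion:
  assumes p: "p \<in> class_H1"
    and no_contact: "\<And>z \<zeta> m. \<lbrakk>norm z < 1; norm \<zeta> = 1; (1::real) \<le> m; p z = exp \<zeta>;
      z * deriv p z = of_real m * (\<zeta> * exp \<zeta>)\<rbrakk> \<Longrightarrow> False"
  shows "p \<prec>\<^sub>s exp"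
proof -
  have disc: "unit_disc = ball 0 1" by (auto simp: unit_disc_def)
  have p0: "p 0 = 1" and pana: "p analytic_on ball 0 1"
    using p by (auto simp: class_H1_def disc)
  then have phol: "p holomorphic_on ball 0 1" by (simp add: analytic_imp_holomorphic)
  have "p ` ball 0 1 \<subseteq> exp ` ball 0 1"
  proof (rule ccontr)
    assume "\<not> ?thesis"
    then obtain z1 where "z1 \<in> ball 0 1" "p z1 \<notin> exp ` ball 0 1" by blast
    then have z1: "norm z1 < 1" "p z1 \<notin> exp ` ball 0 1" by auto
    then have z1: "norm z1 < 1" "p z1 \<notin> exp ` ball 0 1" by auto
    \<comment> \<open>\<open>K\<close> collects the points of a closed disc where \<open>p\<close>
      is outside the image. It is closed because that image is open, so a point of least modulus
      exists.\<close>
    define K where "K = cball 0 (norm z1) \<inter> p -` (- exp ` ball 0 1)"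
    have sub: "cball 0 (norm z1) \<subseteq> ball (0::complex) 1" using z1 by auto
    have contp: "continuous_on (cball 0 (norm z1)) p"
      using phol sub holomorphic_on_imp_continuous_on continuous_on_subset by blast
    have "closed K"
      unfolding K_def by (intro continuous_closed_preimage contp) (auto simp: closed_Compl open_exp_image_disc)
    then have "compact K"
      unfolding compact_eq_bounded_closed by (auto simp: K_def intro: bounded_subset[OF bounded_cball])
    moreover have "K \<noteq> {}" using z1 by (auto simp: K_def)
    ultimately obtain z where z: "z \<in> K" "\<And>y. y \<in> K \<Longrightarrow> norm z \<le> norm y"
      using continuous_attains_inf[of K norm] continuous_on_norm_id by blast
    have zz: "norm z \<le> norm z1" "norm z < 1" "p z \<notin> exp ` ball 0 1" using z(1) z1 by (auto simp: K_def)
    have inside: "p y \<in> exp ` ball 0 1" if "norm y < norm z" for y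
      using z(2)[of y] that zz by (force simp: K_def)
    have "z \<noteq> 0" using zz(3) p0 by (metis centre_in_ball exp_zero imageI zero_less_one)
    \<comment> \<open>By continuity the contact value still lies in the image of the closed disc; as
      it is not in the image of the open one, its logarithm has modulus exactly 1.\<close>
    have "p ` closure (ball 0 (norm z)) \<subseteq> exp ` cball 0 1"
    proof (rule image_closure_subset)
      show "continuous_on (closure (ball 0 (norm z))) p"
        using zz \<open>z \<noteq> 0\<close> by (intro continuous_on_subset[OF contp]) auto
      show "closed (exp ` cball (0::complex) 1)"
        by (intro compact_imp_closed compact_continuous_image continuous_intros) auto
      show "p ` ball 0 (norm z) \<subseteq> exp ` cball 0 1" using inside by force
    qed
    moreover have "z \<in> closure (ball 0 (norm z))" using \<open>z \<noteq> 0\<close> by simp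
    ultimately have "p z \<in> exp ` cball 0 1" by blast
    then obtain \<zeta> where \<zeta>: "p z = exp \<zeta>" "norm \<zeta> \<le> 1" by auto
    then have norm\<zeta>: "norm \<zeta> = 1" using zz(3) by force
    define f where "f y = Ln (p y)" for y
    have fz: "f z = \<zeta>" using \<zeta> Ln_exp_unit_cball by (simp add: f_def)
    have f_inside: "norm (f y) < 1" "p y \<notin> \<real>\<^sub>\<le>\<^sub>0" if "norm y < norm z" for y
      using inside[OF that] Ln_exp_unit_cball by (auto simp: f_def)
    have dp: "(p has_field_derivative deriv p z) (at z)"
      using phol zz by (intro holomorphic_derivI[of _ "ball 0 1"]) auto
    have df: "(f has_field_derivative deriv p z / exp \<zeta>) (at z)"
      unfolding f_def using \<zeta> Ln_exp_unit_cball(2)[OF \<zeta>(2)] dp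
      by (auto intro!: derivative_eq_intros simp: divide_inverse)
    have "f holomorphic_on ball 0 (norm z)"
      unfolding f_def using f_inside(2) zz
      by (intro holomorphic_intros holomorphic_on_subset[OF phol]) auto
    then obtain m where "m \<ge> 1" "z * (deriv p z / exp \<zeta>) = of_real m * f z"
      using Jack_lemma[of f z "deriv p z / exp \<zeta>"] df f_inside(1) fz norm\<zeta> \<open>z \<noteq> 0\<close> p0
      by (auto simp: f_def)
    then show False
      using no_contact[of z \<zeta> m] zz(2) norm\<zeta> \<zeta>(1) fz by (simp add: field_simps)
  qed
  then have range: "p z \<notin> \<real>\<^sub>\<le>\<^sub>0" "norm (Ln (p z)) < 1" "exp (Ln (p z)) = p z" if "norm z < 1" for z
  proof -
    have "z \<in> ball 0 1" using that by simp
    then have "p z \<in> exp ` ball 0 1" using \<open>p ` ball 0 1 \<subseteq> exp ` ball 0 1\<close> by blast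
    then obtain x where "p z = exp x" "norm x < 1" by auto
    then show "p z \<notin> \<real>\<^sub>\<le>\<^sub>0" "norm (Ln (p z)) < 1" "exp (Ln (p z)) = p z"
      using Ln_exp_unit_cball[of x] by auto
  qed
  have "(\<lambda>z. Ln (p z)) holomorphic_on ball 0 1"
    using range(1) by (intro holomorphic_intros phol) auto
  then have "(\<lambda>z. Ln (p z)) analytic_on ball 0 1" by (simp add: analytic_on_open)
  moreover have "exp analytic_on ball (0::complex) 1" by (intro analytic_intros)
  moreover have "Ln (p 0) = 0" using p0 by simp
  moreover have "\<forall>z\<in>ball 0 1. norm (Ln (p z)) < 1 \<and> p z = exp (Ln (p z))"
    using range(2,3) by simp
  ultimately show ?thesis
    unfolding subordinate_def disc using pana by blast
qed

section \<open>Boundary estimate for \<open>p z + \<beta> (z p'(z))\<^sup>2\<close>\<close>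

lemma cos_ge_quadratic: "1 - x\<^sup>2 / 2 \<le> cos x" for x :: real
proof -
  have "(sin (x / 2))\<^sup>2 \<le> (x / 2)\<^sup>2"
    using abs_sin_x_le_abs_x[of "x / 2"] abs_le_square_iff by blast
  then show ?thesis using cos_double_sin[of "x / 2"] by (simp add: power_divide)
qed

lemma exp_one_ge: "exp 1 \<ge> (5/2 :: real)"
  using exp_lower_Taylor_quadratic[of "1::real"] by simp

text \<open>With \<open>u = 1 + Re \<zeta>\<close>, one has
  \<open>Re (exp \<zeta>) = exp (-1) * exp u * cos (Im \<zeta>)\<close> and
  \<open>(Im \<zeta>)\<^sup>2 = 2 * u - u\<^sup>2\<close>. The quadratic lower bounds of the last
  two factors multiply to \<open>1 + u ^ 4 / 4\<close>.\<close>

lemma Re_exp_ge_on_circle: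
  assumes "norm \<zeta> = 1"
  shows "exp (-1) \<le> Re (exp \<zeta>)"
proof -
  define u where "u = 1 + Re \<zeta>"
  have u: "0 \<le> u" using abs_Re_le_cmod[of \<zeta>] assms by (simp add: u_def)
  have "(Re \<zeta>)\<^sup>2 + (Im \<zeta>)\<^sup>2 = 1" using assms cmod_power2[of \<zeta>] by simp
  then have Im: "(Im \<zeta>)\<^sup>2 = 2 * u - u\<^sup>2" by (simp add: u_def power2_eq_square algebra_simps)
  have "1 \<le> (1 + u + u\<^sup>2 / 2) * (1 - u + u\<^sup>2 / 2)"
    using zero_le_power2[of "u * u"] by (simp add: algebra_simps power2_eq_square)
  also have "\<dots> \<le> exp u * cos (Im \<zeta>)"
  proof (rule mult_mono)
    show "1 + u + u\<^sup>2 / 2 \<le> exp u" using exp_lower_Taylor_quadratic u by blast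
    show "1 - u + u\<^sup>2 / 2 \<le> cos (Im \<zeta>)" using cos_ge_quadratic[of "Im \<zeta>"] Im by (simp add: field_simps)
    show "0 \<le> 1 - u + u\<^sup>2 / 2" using zero_le_power2[of "u - 1"] by (simp add: power2_eq_square algebra_simps)
  qed simp
  finally have "1 \<le> exp u * cos (Im \<zeta>)" .
  then have "exp (-1) * 1 \<le> exp (-1) * (exp u * cos (Im \<zeta>))" by (intro mult_left_mono) auto
  then show ?thesis by (simp add: Re_exp u_def exp_add exp_minus field_simps)
qed

text \<open>For \<open>\<zeta> = - cis t\<close> the right-hand side is
  \<open>exp 2 * Re ((\<zeta> * exp \<zeta>)\<^sup>2)\<close>. With \<open>u = 1 - cos t\<close> the
  two factors are at least \<open>1 + 2 * u\<close> and \<open>1 - u\<close>, and their product is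
  at least 1 for \<open>0 \<le> u \<le> 1 / 2\<close>.\<close>

lemma one_le_exp_mult_cos:
  assumes "\<bar>t\<bar> \<le> pi" "1 / 2 < cos t"
  shows "1 \<le> exp (2 * (1 - cos t)) * cos (2 * (t - sin t))"
proof -
  have "\<bar>t\<bar> \<le> pi / 3"
  proof (rule ccontr)
    assume "\<not> ?thesis"
    then have "cos \<bar>t\<bar> < cos (pi / 3)"
      using assms(1) by (intro cos_monotone_0_pi) auto
    then show False using assms(2) by (simp add: cos_60)
  qed
  then have t: "\<bar>t\<bar> \<le> 4 / 3" using pi_less_4 by simp
  define u where "u = 1 - cos t"
  define d where "d = \<bar>t - sin t\<bar>"
  have u: "0 \<le> u" "u \<le> 1 / 2" using assms(2) by (auto simp: u_def)
  have s: "(sin t)\<^sup>2 \<le> 2 * u"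
    unfolding sin_squared_eq u_def using zero_le_power2[of "1 - cos t"]
    by (simp add: power2_eq_square algebra_simps)
  \<comment> \<open>The cubic bound and \<open>\<bar>t\<bar> \<le> 4 / 3\<close> give
    \<open>d \<le> 8 / 27 * \<bar>t\<bar>\<close>. Replacing \<open>\<bar>t\<bar>\<close> by
    \<open>\<bar>sin t\<bar> + d\<close> and solving for \<open>d\<close> produces the factor
    8/19.\<close>
  have "d \<le> \<bar>t\<bar> ^ 3 / 6"
    using Maclaurin_sin_bound[of t 3] by (simp add: d_def sin_coeff_def eval_nat_numeral abs_minus_commute)
  also have "\<dots> = \<bar>t\<bar>\<^sup>2 * \<bar>t\<bar> / 6" by (simp add: eval_nat_numeral)
  also have "\<dots> \<le> (4 / 3)\<^sup>2 * \<bar>t\<bar> / 6"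
    using t by (intro divide_right_mono mult_right_mono power_mono) auto
  also have "\<bar>t\<bar> \<le> \<bar>sin t\<bar> + d" by (auto simp: d_def)
  finally have "d \<le> 8 / 19 * \<bar>sin t\<bar>" by (simp add: power2_eq_square)
  then have "d\<^sup>2 \<le> (8 / 19 * \<bar>sin t\<bar>)\<^sup>2" by (intro power_mono) (auto simp: d_def)
  also have "\<dots> = 64 / 361 * (sin t)\<^sup>2" by (simp add: power_mult_distrib power2_eq_square)
  finally have d2: "d\<^sup>2 \<le> u / 2" using s u by simp
  have "1 \<le> (1 + 2 * u) * (1 - u)"
    using mult_left_mono[OF u(2) u(1)] by (simp add: algebra_simps)
  also have "\<dots> \<le> exp (2 * u) * cos (2 * (t - sin t))"
  proof (rule mult_mono)
    have "(2 * (t - sin t))\<^sup>2 / 2 = 2 * d\<^sup>2"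
      unfolding power_mult_distrib d_def by simp
    then show "1 - u \<le> cos (2 * (t - sin t))"
      using cos_ge_quadratic[of "2 * (t - sin t)"] d2 by linarith
  qed (use u in auto)
  finally show ?thesis by (simp add: u_def)
qed

text \<open>Away from -1 the quadratic term dominates and the triangle inequality suffices. Near -1
  both real parts are at least their values at -1, which add up to
  \<open>exp (-1) + (exp 3 - exp 1) * exp (-2) = exp 1\<close> for the least \<gamma>.\<close>

lemma exp_one_le_norm_add_square:
  fixes \<zeta> :: complex and \<gamma> :: real
  assumes "norm \<zeta> = 1" and \<gamma>: "exp 3 - exp 1 \<le> \<gamma>"
  shows "exp 1 \<le> norm (exp \<zeta> + of_real \<gamma> * (\<zeta> * exp \<zeta>)\<^sup>2)"
proof (cases "Re \<zeta> \<ge> - 1 / 2")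
  case True
  define x where "x = exp (Re \<zeta>)"
  have e3: "exp 3 = (exp 1 :: real) ^ 3" by (simp flip: exp_of_nat_mult)
  have "(5/2) * ((5/2)\<^sup>2 - 1) \<le> exp 1 * ((exp 1)\<^sup>2 - 1 :: real)"
    using exp_one_ge by (intro mult_mono diff_right_mono power_mono) auto
  then have \<gamma>13: "13 \<le> \<gamma>" using \<gamma> e3 by (simp add: power2_eq_square eval_nat_numeral algebra_simps)
  have x: "x \<ge> 1 / 2" using True exp_ge_add_one_self[of "Re \<zeta>"] unfolding x_def by linarith
  have "exp 1 \<le> (1/2) * (13 * (1/2) - 1 :: real)" using e_less_272 by simp
  also have "\<dots> \<le> x * (\<gamma> * x - 1)"
    using x \<gamma>13 by (intro mult_mono diff_right_mono) auto
  also have "\<dots> = norm (of_real \<gamma> * (\<zeta> * exp \<zeta>)\<^sup>2) - norm (exp \<zeta>)"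
    using assms(1) \<gamma>13 by (simp add: norm_mult norm_power x_def power2_eq_square algebra_simps)
  also have "\<dots> \<le> norm (exp \<zeta> + of_real \<gamma> * (\<zeta> * exp \<zeta>)\<^sup>2)"
    using norm_diff_ineq[of "of_real \<gamma> * (\<zeta> * exp \<zeta>)\<^sup>2" "exp \<zeta>"] by (simp add: add.commute)
  finally show ?thesis .
next
  case False
  define t where "t = Arg (- \<zeta>)"
  have \<zeta>: "\<zeta> = - cis t"
  proof -
    have "\<zeta> \<noteq> 0" using assms(1) by auto
    then have "cis t = - \<zeta>" using assms(1) cis_Arg[of "- \<zeta>"] by (auto simp: t_def sgn_eq)
    then show ?thesis by simp
  qed
  then have Re: "Re \<zeta> = - cos t" by simp
  have "\<bar>t\<bar> \<le> pi" using Arg_bounded[of "-\<zeta>"] by (auto simp: t_def)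
  then have "1 \<le> exp (2 * (1 - cos t)) * cos (2 * (t - sin t))"
    using False Re by (intro one_le_exp_mult_cos) auto
  then have "exp (-2) * 1 \<le> exp (-2) * (exp (2 * (1 - cos t)) * cos (2 * (t - sin t)))"
    by (intro mult_left_mono) auto
  also have "\<dots> = exp (-2 * cos t) * cos (2 * (t - sin t))"
  proof -
    have "exp (-2) * exp (2 * (1 - cos t)) = exp (-2 * cos t)"
      by (subst exp_add[symmetric]) (simp add: algebra_simps)
    then show ?thesis by (simp only: mult.assoc[symmetric])
  qed
  also have "\<dots> = Re ((\<zeta> * exp \<zeta>)\<^sup>2)"
  proof -
    have "exp \<zeta> = of_real (exp (- cos t)) * cis (- sin t)"
      by (simp add: \<zeta> exp_eq_polar)
    then have "\<zeta> * exp \<zeta> = - (of_real (exp (- cos t)) * cis (t - sin t))"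
      by (simp add: \<zeta> cis_mult)
    then have "(\<zeta> * exp \<zeta>)\<^sup>2 = of_real (exp (- cos t) ^ 2) * cis (2 * (t - sin t))"
      by (simp add: power_mult_distrib Complex.DeMoivre)
    then show ?thesis by (simp flip: exp_of_nat_mult)
  qed
  finally have "exp (-2) \<le> Re ((\<zeta> * exp \<zeta>)\<^sup>2)" by simp
  moreover have "0 \<le> \<gamma>"
  proof -
    have "exp 1 \<le> exp (3::real)" by simp
    then show ?thesis using \<gamma> by linarith
  qed
  ultimately have "(exp 3 - exp 1) * exp (-2) \<le> \<gamma> * Re ((\<zeta> * exp \<zeta>)\<^sup>2)"
    using \<gamma> by (intro mult_mono) auto
  moreover have "(exp 3 - exp 1) * exp (-2) = exp 1 - exp (-1 :: real)"
    by (simp add: left_diff_distrib flip: exp_add)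
  ultimately have "exp 1 \<le> Re (exp \<zeta>) + \<gamma> * Re ((\<zeta> * exp \<zeta>)\<^sup>2)"
    using Re_exp_ge_on_circle[OF assms(1)] by linarith
  also have "\<dots> = Re (exp \<zeta> + of_real \<gamma> * (\<zeta> * exp \<zeta>)\<^sup>2)" by simp
  also have "\<dots> \<le> norm (exp \<zeta> + of_real \<gamma> * (\<zeta> * exp \<zeta>)\<^sup>2)" by (rule complex_Re_le_cmod)
  finally show ?thesis .
qed

section \<open>Boundary estimate for the quotient by \<open>p z\<close>\<close>

text \<open>With \<open>v = 1 + Re \<zeta>\<close>, the squared modulus is
  \<open>exp (-2) * exp (2 * v) * Q\<close> for a quadratic \<open>Q\<close> in \<open>v\<close>
  with value \<open>(\<gamma> + 1)\<^sup>2\<close> at \<open>v = 0\<close>. The linear bound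
  \<open>1 + 2 * v\<close> for the exponential compensates the decrease of \<open>Q\<close>.\<close>

lemma exp_one_le_norm_exp_mult:
  fixes \<zeta> :: complex and \<gamma> :: real
  assumes "norm \<zeta> = 1" and \<gamma>: "exp 2 - 1 \<le> \<gamma>"
  shows "exp 1 \<le> norm (exp \<zeta> * (1 + of_real \<gamma> * \<zeta>\<^sup>2))"
proof -
  define v where "v = 1 + Re \<zeta>"
  have v: "0 \<le> v" using abs_Re_le_cmod[of \<zeta>] assms by (simp add: v_def)
  have unit: "(Re \<zeta>)\<^sup>2 + (Im \<zeta>)\<^sup>2 = 1" using assms cmod_power2[of \<zeta>] by simp
  have e2: "exp 2 = (exp 1 :: real) ^ 2" by (simp flip: exp_of_nat_mult)
  have "(5/2)\<^sup>2 \<le> (exp 1 :: real)\<^sup>2" using exp_one_ge by (intro power_mono) auto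
  then have \<gamma>4: "4 \<le> \<gamma>" using \<gamma> e2 by (simp add: power2_eq_square)
  define Q where "Q = (\<gamma> + 1)\<^sup>2 - 8 * \<gamma> * v + 4 * \<gamma> * v\<^sup>2"
  have Im2: "(Im \<zeta>)\<^sup>2 = 2 * v - v\<^sup>2"
    using unit by (simp add: v_def power2_eq_square algebra_simps)
  have Re: "Re \<zeta> = v - 1" by (simp add: v_def)
  have "(norm (1 + of_real \<gamma> * \<zeta>\<^sup>2))\<^sup>2 = (1 + \<gamma> * ((Re \<zeta>)\<^sup>2 - (Im \<zeta>)\<^sup>2))\<^sup>2 + 4 * \<gamma>\<^sup>2 * (Re \<zeta>)\<^sup>2 * (Im \<zeta>)\<^sup>2"
    unfolding cmod_power2 by (simp add: power2_eq_square algebra_simps)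
  also have "\<dots> = Q"
    unfolding Im2 Re Q_def by (simp add: power2_eq_square algebra_simps)
  finally have Q: "(norm (1 + of_real \<gamma> * \<zeta>\<^sup>2))\<^sup>2 = Q" .
  \<comment> \<open>Completing the square in \<open>4 * v\<^sup>2 - 6 * v\<close> leaves the
    condition \<open>9 / 4 * \<gamma> \<le> (\<gamma> - 1)\<^sup>2\<close>, whose two sides agree at
    4 and 1/4.\<close>
  have "0 \<le> (\<gamma> - 4) * (4 * \<gamma> - 1)" using \<gamma>4 by simp
  then have "0 \<le> (\<gamma> - 1)\<^sup>2 - 9 / 4 * \<gamma>" by (simp add: power2_eq_square algebra_simps)
  moreover have "0 \<le> \<gamma> * (2 * v - 3 / 2)\<^sup>2" using \<gamma>4 by simp
  ultimately have "0 \<le> (\<gamma> - 1)\<^sup>2 - 6 * \<gamma> * v + 4 * \<gamma> * v\<^sup>2"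
    by (simp add: power2_eq_square algebra_simps)
  then have "0 \<le> 2 * v * ((\<gamma> - 1)\<^sup>2 - 6 * \<gamma> * v + 4 * \<gamma> * v\<^sup>2)" using v by simp
  also have "\<dots> = (1 + 2 * v) * Q - (\<gamma> + 1)\<^sup>2"
    by (simp add: Q_def power2_eq_square algebra_simps)
  finally have "(\<gamma> + 1)\<^sup>2 \<le> (1 + 2 * v) * Q" by simp
  also have "\<dots> \<le> exp (2 * v) * Q"
    unfolding Q[symmetric] by (intro mult_right_mono) auto
  finally have "(\<gamma> + 1)\<^sup>2 \<le> exp (2 * v) * Q" .
  moreover have "(exp 2)\<^sup>2 \<le> (\<gamma> + 1)\<^sup>2" using \<gamma> by (intro power_mono) auto
  ultimately have "exp (-2) * (exp 2)\<^sup>2 \<le> exp (-2) * (exp (2 * v) * Q)" by (intro mult_left_mono) auto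
  moreover have "exp (-2) * (exp 2)\<^sup>2 = (exp 1 :: real)\<^sup>2"
    by (simp add: power2_eq_square flip: exp_add)
  moreover have "exp (-2) * (exp (2 * v) * Q) = (exp (Re \<zeta>))\<^sup>2 * Q"
    by (simp add: power2_eq_square v_def algebra_simps flip: exp_add)
  ultimately have "(exp 1)\<^sup>2 \<le> (norm (exp \<zeta> * (1 + of_real \<gamma> * \<zeta>\<^sup>2)))\<^sup>2"
    by (simp add: norm_mult power_mult_distrib Q)
  then show ?thesis by (rule power2_le_imp_le) simp
qed

section \<open>Boundary estimate for the quotient by \<open>(p z)\<^sup>2\<close>\<close>

text \<open>The distance of \<open>(- \<zeta>) ^ k\<close> from 1 is at most \<open>k\<close> times
  that of \<open>- \<zeta>\<close>. On the unit circle
  \<open>(norm (x - 1))\<^sup>2 = 2 * (1 - Re x)\<close>, so squaring gives the factor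
  \<open>k\<^sup>2\<close>.\<close>

lemma Re_power_unit_circle:
  fixes \<zeta> :: complex
  assumes "norm \<zeta> = 1"
  shows "\<bar>Re (\<zeta> ^ k) - (-1) ^ k\<bar> \<le> (real k)\<^sup>2 * (1 + Re \<zeta>)"
proof -
  have dist: "(norm (x - 1))\<^sup>2 = 2 * (1 - Re x)" if "norm x = 1" for x :: complex
    using cmod_power2[of x] cmod_power2[of "x - 1"] that by (simp add: power2_eq_square algebra_simps)
  have "norm ((- \<zeta>) ^ k - 1 ^ k) \<le> real k * norm (- \<zeta> - 1)"
    using assms by (intro norm_power_diff) auto
  then have "(norm ((- \<zeta>) ^ k - 1))\<^sup>2 \<le> (real k * norm (- \<zeta> - 1))\<^sup>2"
    by (intro power_mono) auto
  then have "1 - Re ((- \<zeta>) ^ k) \<le> (real k)\<^sup>2 * (1 + Re \<zeta>)"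
    using dist[of "(- \<zeta>) ^ k"] dist[of "- \<zeta>"] assms
    by (simp add: power_mult_distrib norm_power algebra_simps)
  moreover have "Re ((- \<zeta>) ^ k) \<le> 1"
    using complex_Re_le_cmod[of "(- \<zeta>) ^ k"] assms by (simp add: norm_power)
  ultimately show ?thesis
    by (cases "even k") (auto simp: power_minus_odd)
qed

text \<open>Write \<open>(n - 2)\<^sup>2 = n * (n - 1) - 3 * n + 4\<close>; each of
  \<open>n * (n - 1)\<close>, \<open>n\<close> and 1, divided by \<open>fact n\<close>, sums to
  \<open>exp 1\<close>.\<close>

lemma sums_shifted_square_div_fact: "(\<lambda>n. (real n - 2)\<^sup>2 / fact n) sums (2 * exp 1)"
proof -
  have 0: "(\<lambda>n. 1 / fact n) sums (exp 1 :: real)"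
    using exp_converges[of "1::real"] by (simp add: divide_inverse)
  have "(\<lambda>n. real (Suc n) / fact (Suc n)) sums (exp 1)"
    using 0 by (simp add: field_simps del: of_nat_Suc)
  from sums_Suc[OF this] have 1: "(\<lambda>n. real n / fact n) sums exp 1" by simp
  have "(\<lambda>n. real (Suc n) * real n / fact (Suc n)) sums (exp 1)"
    using 1 by (simp add: field_simps del: of_nat_Suc)
  then have "(\<lambda>n. real (Suc n) * (real (Suc n) - 1) / fact (Suc n)) sums (exp 1)" by simp
  from sums_Suc[OF this] have 2: "(\<lambda>n. real n * (real n - 1) / fact n) sums exp 1" by simp
  have "(\<lambda>n. real n * (real n - 1) / fact n - 3 * (real n / fact n) + 4 * (1 / fact n)) sums
      (exp 1 - 3 * exp 1 + 4 * exp 1)"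
    by (intro sums_add sums_diff sums_mult 0 1 2)
  moreover have "real n * (real n - 1) / fact n - 3 * (real n / fact n) + 4 * (1 / fact n)
      = (real n - 2)\<^sup>2 / fact n" for n
    by (simp add: field_simps power2_eq_square)
  ultimately show ?thesis by simp
qed

lemma Re_rotated_exp_ge:
  fixes \<zeta> :: complex
  assumes "norm \<zeta> = 1"
  shows "exp (-1) - 1 \<le> Re ((cnj \<zeta>)\<^sup>2 * (exp \<zeta> - 1))"
proof -
  define u where "u = 1 + Re \<zeta>"
  have u: "0 \<le> u" using abs_Re_le_cmod[of \<zeta>] assms by (simp add: u_def)
  \<comment> \<open>Equality holds at \<open>\<zeta> = -1\<close>, so every estimate has to carry the factor \<open>u = 1 + Re \<zeta>\<close>. The
    correction \<open>(n - 2)\<^sup>2 u\<close> makes the terms with \<open>n \<ge> 4\<close> nonnegative and contributes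
    \<open>2 e u \<le> 6 u\<close> in total, less than the first four terms give back.\<close>
  define b where "b n = (Re ((cnj \<zeta>)\<^sup>2 * \<zeta> ^ n) - (-1) ^ n + (real n - 2)\<^sup>2 * u) / fact n" for n
  have cnj: "cnj \<zeta> * \<zeta> = 1" using assms complex_norm_square[of \<zeta>] by (simp add: mult.commute)
  have "(\<lambda>n. (cnj \<zeta>)\<^sup>2 * (\<zeta> ^ n /\<^sub>R fact n)) sums ((cnj \<zeta>)\<^sup>2 * exp \<zeta>)"
    by (intro sums_mult exp_converges)
  then have "(\<lambda>n. Re ((cnj \<zeta>)\<^sup>2 * \<zeta> ^ n) / fact n) sums Re ((cnj \<zeta>)\<^sup>2 * exp \<zeta>)"
    by (drule_tac sums_Re) (simp add: divide_inverse mult.commute)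
  moreover have "(\<lambda>n. (-1) ^ n / fact n) sums (exp (-1) :: real)"
    using exp_converges[of "-1::real"] by (simp add: divide_inverse mult.commute)
  ultimately have "(\<lambda>n. Re ((cnj \<zeta>)\<^sup>2 * \<zeta> ^ n) / fact n - (-1) ^ n / fact n + (real n - 2)\<^sup>2 / fact n * u)
      sums (Re ((cnj \<zeta>)\<^sup>2 * exp \<zeta>) - exp (-1) + 2 * exp 1 * u)"
    by (intro sums_add sums_diff sums_mult2 sums_shifted_square_div_fact)
  then have b_sums: "b sums (Re ((cnj \<zeta>)\<^sup>2 * exp \<zeta>) - exp (-1) + 2 * exp 1 * u)"
    by (simp add: b_def [abs_def] add_divide_distrib diff_divide_distrib)
  have low: "Re ((cnj \<zeta>)\<^sup>2 * \<zeta>) = Re \<zeta>" "(cnj \<zeta>)\<^sup>2 * \<zeta>\<^sup>2 = 1"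
  proof -
    have "(cnj \<zeta>)\<^sup>2 * \<zeta> = cnj \<zeta>" using cnj by (simp add: power2_eq_square mult.assoc)
    then show "Re ((cnj \<zeta>)\<^sup>2 * \<zeta>) = Re \<zeta>" by simp
    show "(cnj \<zeta>)\<^sup>2 * \<zeta>\<^sup>2 = 1" using cnj by (simp flip: power_mult_distrib)
  qed
  \<comment> \<open>\<open>cnj \<zeta>\<close> inverts \<zeta>, so the rotation lowers exponents by
    2; this is why the correction in \<open>b n\<close> is centred at 2.\<close>
  have shift: "(cnj \<zeta>)\<^sup>2 * \<zeta> ^ (k + 2) = \<zeta> ^ k" for k
  proof -
    have "(cnj \<zeta>)\<^sup>2 * \<zeta> ^ (k + 2) = (cnj \<zeta>)\<^sup>2 * \<zeta>\<^sup>2 * \<zeta> ^ k"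
      by (simp only: power_add mult_ac)
    then show ?thesis using low(2) by simp
  qed
  have b_nonneg: "0 \<le> b n" if "n \<notin> {..<4}" for n
  proof -
    define k where "k = n - 2"
    have n: "n = k + 2" using that by (auto simp: k_def)
    have "0 \<le> Re (\<zeta> ^ k) - (-1) ^ k + (real k)\<^sup>2 * u"
      using Re_power_unit_circle[OF assms, of k] by (simp add: u_def)
    then show ?thesis unfolding b_def n shift by simp
  qed
  have "sum b {..<4} \<le> suminf b"
    using b_nonneg sums_summable[OF b_sums] by (intro sum_le_suminf) auto
  also have "suminf b = Re ((cnj \<zeta>)\<^sup>2 * exp \<zeta>) - exp (-1) + 2 * exp 1 * u"
    using b_sums by (rule sums_unique[symmetric])
  also have "sum b {..<4} = b 0 + b 1 + b 2 + b 3" by (simp add: eval_nat_numeral)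
  \<comment> \<open>The part \<open>Re ((cnj \<zeta>)\<^sup>2) - 1\<close> of \<open>b 0\<close>
    matches the subtraction of 1 from \<open>exp \<zeta>\<close> and the -1 in the claim, leaving
    \<open>6 * u + u / 3\<close> against \<open>2 * exp 1 * u\<close>.\<close>
  also have "\<dots> = Re ((cnj \<zeta>)\<^sup>2) - 1 + 4 * u + 2 * u + u / 3"
  proof -
    have "b 0 = Re ((cnj \<zeta>)\<^sup>2) - 1 + 4 * u" by (simp add: b_def)
    moreover have "b 1 = 2 * u" using low(1) by (simp add: b_def u_def)
    moreover have "b 2 = 0" using low(2) by (simp add: b_def)
    moreover have "b 3 = u / 3"
    proof -
      have "(cnj \<zeta>)\<^sup>2 * \<zeta> ^ 3 = \<zeta>" using shift[of 1] by (simp add: numeral_3_eq_3)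
      then show ?thesis by (simp add: b_def u_def fact_numeral)
    qed
    ultimately show ?thesis by simp
  qed
  finally have "Re ((cnj \<zeta>)\<^sup>2) - 1 + 6 * u \<le> Re ((cnj \<zeta>)\<^sup>2 * exp \<zeta>) - exp (-1) + 2 * exp 1 * u"
    using u by simp
  moreover have "2 * exp 1 * u \<le> 6 * u"
    using exp_le u by (intro mult_right_mono) auto
  ultimately show ?thesis by (simp add: algebra_simps)
qed

text \<open>Multiplication by the unimodular \<open>(cnj \<zeta>)\<^sup>2\<close> turns the \<gamma>
  term into the constant \<gamma>, so a real part bounds the norm. The centre 1 matters: for the
  least \<gamma> and \<open>\<zeta> = \<i>\<close>, the modulus of
  \<open>exp \<zeta> + \<gamma> * \<zeta>\<^sup>2\<close> is only about 2.\<close>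

lemma exp_one_minus_one_le_norm:
  fixes \<zeta> :: complex and \<gamma> :: real
  assumes "norm \<zeta> = 1" and \<gamma>: "exp 1 - exp (-1) \<le> \<gamma>"
  shows "exp 1 - 1 \<le> norm (exp \<zeta> + of_real \<gamma> * \<zeta>\<^sup>2 - 1)"
proof -
  have cnj: "(cnj \<zeta>)\<^sup>2 * \<zeta>\<^sup>2 = 1"
    using assms complex_norm_square[of \<zeta>] by (simp add: mult.commute flip: power_mult_distrib)
  have "exp 1 - 1 \<le> Re ((cnj \<zeta>)\<^sup>2 * (exp \<zeta> - 1) + of_real \<gamma>)"
    using Re_rotated_exp_ge[OF assms(1)] \<gamma> by simp
  also have "(cnj \<zeta>)\<^sup>2 * (exp \<zeta> - 1) + of_real \<gamma> = (cnj \<zeta>)\<^sup>2 * (exp \<zeta> + of_real \<gamma> * \<zeta>\<^sup>2 - 1)"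
    using cnj by (simp add: algebra_simps)
  also have "Re \<dots> \<le> norm ((cnj \<zeta>)\<^sup>2 * (exp \<zeta> + of_real \<gamma> * \<zeta>\<^sup>2 - 1))"
    by (rule complex_Re_le_cmod)
  also have "\<dots> = norm (exp \<zeta> + of_real \<gamma> * \<zeta>\<^sup>2 - 1)"
    using assms(1) by (simp add: norm_mult norm_power)
  finally show ?thesis .
qed

section \<open>Discs containing the image of the unit disc under \<open>exp\<close>\<close>

text \<open>The power series of \<open>exp x - 1\<close> has nonnegative coefficients, so it is
  majorised termwise by its value at \<open>norm x\<close>.\<close>

lemma norm_exp_minus_one_le: "norm (exp x - 1) \<le> exp (norm x) - 1" for x :: complex
proof (rule norm_sums_le)
  show "(\<lambda>n. x ^ Suc n /\<^sub>R fact (Suc n)) sums (exp x - 1)"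
    using exp_converges[of x] by (subst sums_Suc_iff) simp
  show "(\<lambda>n. norm x ^ Suc n /\<^sub>R fact (Suc n)) sums (exp (norm x) - 1)"
    using exp_converges[of "norm x"] by (subst sums_Suc_iff) simp
qed (simp add: norm_mult norm_power)

lemma subordinate_exp_imp_in_image: "F \<prec>\<^sub>s exp \<Longrightarrow> norm z < 1 \<Longrightarrow> F z \<in> exp ` ball 0 1"
  unfolding subordinate_def unit_disc_def by force

lemma exp_disc_norm_less: "w \<in> exp ` ball 0 1 \<Longrightarrow> norm w < exp 1"
  for w :: complex
  using complex_Re_le_cmod le_less_trans by fastforce

lemma exp_disc_norm_minus_one_less: "w \<in> exp ` ball 0 1 \<Longrightarrow> norm (w - 1) < exp 1 - 1"
  for w :: complex
proof -
  assume "w \<in> exp ` ball 0 1"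
  then obtain x where x: "w = exp x" "norm x < 1" by auto
  then have "exp (norm x) < exp 1" by simp
  then show ?thesis unfolding x(1) using norm_exp_minus_one_le[of x] by linarith
qed

theorem theorem4p6:
  fixes p :: "complex \<Rightarrow> complex" and \<beta> :: real
  assumes "p \<in> class_H1"
  shows
    "(\<beta> \<ge> exp 3 - exp 1 \<and>
        (\<lambda>z. p z + of_real \<beta> * (z * deriv p z)\<^sup>2) \<prec>\<^sub>s exp
      \<longrightarrow> p \<prec>\<^sub>s exp) \<and>
     (\<beta> \<ge> exp 2 - 1 \<and>
        remove_sings (\<lambda>z. p z + of_real \<beta> * ((z * deriv p z)\<^sup>2 / p z)) \<prec>\<^sub>s exp
      \<longrightarrow> p \<prec>\<^sub>s exp) \<and>
     (\<beta> \<ge> exp 1 - exp (-1) \<and>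
        remove_sings (\<lambda>z. p z + of_real \<beta> * ((z * deriv p z)\<^sup>2 / (p z)\<^sup>2)) \<prec>\<^sub>s exp
      \<longrightarrow> p \<prec>\<^sub>s exp)"
proof -
  have "p analytic_on ball 0 1"
    using assms by (auto simp: class_H1_def unit_disc_def ball_def dist_norm)
  then have p_at: "p analytic_on {z}" if "norm z < 1" for z
    using that analytic_on_subset by auto
  \<comment> \<open>The factor from Jack's lemma enters squared, so the boundary estimates are
    applied with \<open>\<gamma> = \<beta> * m\<^sup>2\<close>.\<close>
  have \<beta>_le: "\<beta> \<le> \<beta> * m\<^sup>2" if "1 \<le> m" "0 \<le> \<beta>" for m
    using that mult_left_mono[of 1 "m\<^sup>2" \<beta>] by (simp add: one_le_power)
  show ?thesis
  proof (intro conjI impI; elim conjE)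
    assume \<beta>: "exp 3 - exp 1 \<le> \<beta>"
      and sub: "(\<lambda>z. p z + of_real \<beta> * (z * deriv p z)\<^sup>2) \<prec>\<^sub>s exp"
    have "exp 1 \<le> exp (3::real)" by simp
    then have \<beta>0: "0 \<le> \<beta>" using \<beta> by linarith
    show "p \<prec>\<^sub>s exp"
    proof (rule subordinate_exp_criterion[OF assms])
      fix z \<zeta> :: complex and m :: real
      assume z: "norm z < 1" and \<zeta>: "norm \<zeta> = 1" and m: "1 \<le> m" and contact: "p z = exp \<zeta>"
        "z * deriv p z = of_real m * (\<zeta> * exp \<zeta>)"
      have "p z + of_real \<beta> * (z * deriv p z)\<^sup>2 = exp \<zeta> + of_real (\<beta> * m\<^sup>2) * (\<zeta> * exp \<zeta>)\<^sup>2"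
        by (simp add: contact power_mult_distrib mult_ac)
      then have "norm (exp \<zeta> + of_real (\<beta> * m\<^sup>2) * (\<zeta> * exp \<zeta>)\<^sup>2) < exp 1"
        using exp_disc_norm_less[OF subordinate_exp_imp_in_image[OF sub z]] by simp
      then show False using exp_one_le_norm_add_square[OF \<zeta>, of "\<beta> * m\<^sup>2"] \<beta> \<beta>_le[OF m \<beta>0] by linarith
    qed
  next
    assume \<beta>: "exp 2 - 1 \<le> \<beta>"
      and sub: "remove_sings (\<lambda>z. p z + of_real \<beta> * ((z * deriv p z)\<^sup>2 / p z)) \<prec>\<^sub>s exp"
    have "1 \<le> exp (2::real)" by simp
    then have \<beta>0: "0 \<le> \<beta>" using \<beta> by linarith
    show "p \<prec>\<^sub>s exp"
    proof (rule subordinate_exp_criterion[OF assms])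
      fix z \<zeta> :: complex and m :: real
      assume z: "norm z < 1" and \<zeta>: "norm \<zeta> = 1" and m: "1 \<le> m" and contact: "p z = exp \<zeta>"
        "z * deriv p z = of_real m * (\<zeta> * exp \<zeta>)"
      \<comment> \<open>At a contact point \<open>p z = exp \<zeta>\<close> is nonzero, so the
        quotient is analytic there and \<open>remove_sings\<close> keeps its value, whatever zeros
        \<open>p\<close> has elsewhere.\<close>
      have "(\<lambda>z. p z + of_real \<beta> * ((z * deriv p z)\<^sup>2 / p z)) analytic_on {z}"
        using p_at[OF z] contact(1) by (intro analytic_intros) auto
      then have "remove_sings (\<lambda>z. p z + of_real \<beta> * ((z * deriv p z)\<^sup>2 / p z)) z
          = p z + of_real \<beta> * ((z * deriv p z)\<^sup>2 / p z)"
        by (rule remove_sings_at_analytic)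
      also have "\<dots> = exp \<zeta> * (1 + of_real (\<beta> * m\<^sup>2) * \<zeta>\<^sup>2)"
        by (simp add: contact field_simps power2_eq_square)
      finally have "norm (exp \<zeta> * (1 + of_real (\<beta> * m\<^sup>2) * \<zeta>\<^sup>2)) < exp 1"
        using exp_disc_norm_less[OF subordinate_exp_imp_in_image[OF sub z]] by simp
      then show False using exp_one_le_norm_exp_mult[OF \<zeta>, of "\<beta> * m\<^sup>2"] \<beta> \<beta>_le[OF m \<beta>0] by linarith
    qed
  next
    assume \<beta>: "exp 1 - exp (-1) \<le> \<beta>"
      and sub: "remove_sings (\<lambda>z. p z + of_real \<beta> * ((z * deriv p z)\<^sup>2 / (p z)\<^sup>2)) \<prec>\<^sub>s exp"
    have "exp (-1) \<le> exp (1::real)" by simp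
    then have \<beta>0: "0 \<le> \<beta>" using \<beta> by linarith
    show "p \<prec>\<^sub>s exp"
    proof (rule subordinate_exp_criterion[OF assms])
      fix z \<zeta> :: complex and m :: real
      assume z: "norm z < 1" and \<zeta>: "norm \<zeta> = 1" and m: "1 \<le> m" and contact: "p z = exp \<zeta>"
        "z * deriv p z = of_real m * (\<zeta> * exp \<zeta>)"
      have "(\<lambda>z. p z + of_real \<beta> * ((z * deriv p z)\<^sup>2 / (p z)\<^sup>2)) analytic_on {z}"
        using p_at[OF z] contact(1) by (intro analytic_intros) auto
      then have "remove_sings (\<lambda>z. p z + of_real \<beta> * ((z * deriv p z)\<^sup>2 / (p z)\<^sup>2)) z
          = p z + of_real \<beta> * ((z * deriv p z)\<^sup>2 / (p z)\<^sup>2)"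
        by (rule remove_sings_at_analytic)
      also have "\<dots> = exp \<zeta> + of_real (\<beta> * m\<^sup>2) * \<zeta>\<^sup>2"
        by (simp add: contact field_simps power2_eq_square)
      finally have "norm (exp \<zeta> + of_real (\<beta> * m\<^sup>2) * \<zeta>\<^sup>2 - 1) < exp 1 - 1"
        using exp_disc_norm_minus_one_less[OF subordinate_exp_imp_in_image[OF sub z]] by simp
      then show False using exp_one_minus_one_le_norm[OF \<zeta>, of "\<beta> * m\<^sup>2"] \<beta> \<beta>_le[OF m \<beta>0] by linarith
    qed
  qed
qed

end
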